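(* Let $F:X\to\mathcal P(Y)$ be radially upper Hausdorff continuous with respect to $x_0\in\operatorname{dom}F$, let $\operatorname{dom}F$ be star shaped at $x_0$, and let $F(x_0)$ be compact. Assume moreover that for every $w^*\in W^*$ the scalarization $\varphi_{F,w^*}$ is proper, radially pseudoconvex with respect to $x_0$ and radially pseudoconcave with respect to $x_0$. If $$\forall x\in X\ \exists w^*\in W^*:\quad (\varphi_{F,w^*})^{\downarrow}(x,x_0-x)\le 0,$$ then $x_0$ is a weak minimizer of $F$.
   Context: Setting: $X,Y$ are real locally convex Hausdorff spaces; $\mathcal U_X(0),\mathcal U_Y(0)$ are $0$-neighborhood bases consisting of balanced convex open sets. $Y$ is pre-ordered by a closed convex cone $C\subseteq Y$ with $\operatorname{int}C\ne\emptyset$ and $C\ne Y$. $\mathcal P(Y)$ is the set of all subsets of $Y$. $C^+=\{y^*\in Y^*: y^*(c)\ge 0\ \forall c\in C\}$, and $W^*$ is a fixed weak$^*$-compact base of $C^+$ (it exists because $\operatorname{int}C\neq\emptyset$). $\overline{\mathbb R}=\mathbb R\cup\{\pm\infty\}$, with $\inf\emptyset=+\infty$ and $(\pm\infty)+r=\pm\infty$ for $r\in\mathbb R$. $\operatorname{dom}F=\{x\in X: F(x)\ne\emptyset\}$. It is star shaped at $x_0$ if $x_0,x\in\operatorname{dom}F$ implies $x_0+t(x-x_0)\in\operatorname{dom}F$ for all $t\in[0,1]$. Scalarization: $\varphi_{F,w^*}:X\to\overline{\mathbb R}$, $\varphi_{F,w^*}(x)=\inf\{w^*(y): y\in F(x)\}$.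 For $\varphi:X\to\overline{\mathbb R}$, $\operatorname{dom}\varphi=\{x:\varphi(x)\ne+\infty\}$; $\varphi$ is proper if $\operatorname{dom}\varphi\neq\emptyset$ and $\varphi$ never takes the value $-\infty$. Lower Dini derivative: $\varphi^{\downarrow}(x,u)=\liminf_{t\downarrow0}\frac1t\inf\{\rho\in\mathbb R:\varphi(x+tu)\le\varphi(x)+\rho\}$ (also for functions on $\mathbb R$). A function $\varphi$ with values in $\overline{\mathbb R}$ is pseudoconvex if for all $a,b\in\operatorname{dom}\varphi$, $\varphi(a)<\varphi(b)$ implies $\varphi^\downarrow(b,a-b)<0$; it is pseudoconcave if for all $a,b\in\operatorname{dom}\varphi$, $\varphi(a)>\varphi(b)$ implies $\varphi^\downarrow(b,a-b)>0$. Radial notions: for $x\in X$, $\varphi_{x_0,x}:\mathbb R\to\overline{\mathbb R}$ is $\varphi_{x_0,x}(t)=\varphi(x_0+t(x-x_0))$ for $0\le t\le1$ and $+\infty$ elsewhere. $\varphi$ is radially pseudoconvex (pseudoconcave) w.r.t. $x_0$ if $\varphi_{x_0,x}$ is pseudoconvex (pseudoconcave) for all $x\in X$. Similarly $F_{x_0,x}:\mathbb R\to\mathcal P(Y)$ is $F_{x_0,x}(t)=F(x_0+t(x-x_0))$ for $0\le t\le 1$ and $\emptyset$ elsewhere. A set-valued function $G:Z\to\mathcal P(Y)$ on a locally convex space $Z$ is upper Hausdorff continuous at $z_0$ if for all $U\in\mathcal U_Y(0)$ there is a $0$-neighborhood $V\subseteq Z$ with $G(z)\subseteq G(z_0)+U$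 for all $z\in z_0+V$. $F$ is radially upper Hausdorff continuous w.r.t. $x_0$ if for every $x\in X$, $F_{x_0,x}$ is upper Hausdorff continuous at every $t\in[0,1]$. For $A,B\in\mathcal P(Y)$: $A\ll B$ iff there is $U\in\mathcal U_Y(0)$ with $B+U\subseteq A+C$. A point $x_0\in\operatorname{dom}F$ is a weak minimizer of $F$ if either $F(x_0)+C=Y$ or $F(x)\not\ll F(x_0)$ for all $x\in X$. *)

theory Defs
  imports "HOL-Analysis.Analysis"
begin

text \<open>Real locally convex Hausdorff spaces. Convexity is unfolded because \<open>convex\<close> cannot be used
  in a class specification.\<close>

class locally_convex_space = real_vector + topological_ab_group_add + t2_space +
  assumes tendsto_scaleR_Pair:
    "LIM p (nhds r \<times>\<^sub>F nhds x). fst p *\<^sub>R snd p :> nhds (r *\<^sub>R x)"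
  and convex_zero_nbhd:
    "open N \<Longrightarrow> 0 \<in> N \<Longrightarrow> \<exists>U. open U \<and> 0 \<in> U \<and> U \<subseteq> N \<and>
       (\<forall>x\<in>U. \<forall>y\<in>U. \<forall>u\<ge>0. \<forall>v\<ge>0. u + v = 1 \<longrightarrow> u *\<^sub>R x + v *\<^sub>R y \<in> U)"

instance real_normed_vector \<subseteq> locally_convex_space
proof
  fix r :: real and x :: 'a
  have "((\<lambda>p. fst p *\<^sub>R snd p) \<longlongrightarrow> r *\<^sub>R x) (nhds r \<times>\<^sub>F nhds x)"
    by (intro tendsto_scaleR filterlim_fst filterlim_snd)
  then show "LIM p (nhds r \<times>\<^sub>F nhds x). fst p *\<^sub>R snd p :> nhds (r *\<^sub>R x)" .
next
  fix N :: "'a set"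
  assume "open N" "0 \<in> N"
  then obtain e where "e > 0" "ball 0 e \<subseteq> N"
    by (meson open_contains_ball)
  then show "\<exists>U. open U \<and> 0 \<in> U \<and> U \<subseteq> N \<and>
      (\<forall>x\<in>U. \<forall>y\<in>U. \<forall>u\<ge>0. \<forall>v\<ge>0. u + v = 1 \<longrightarrow> u *\<^sub>R x + v *\<^sub>R y \<in> U)"
    using convex_ball[of "0::'a" e]
    by (intro exI[of _ "ball 0 e"]) (simp add: convex_def)
qed

definition balanced :: "'a::real_vector set \<Rightarrow> bool" where
  "balanced U \<longleftrightarrow> (\<forall>r u. \<bar>r\<bar> \<le> 1 \<and> u \<in> U \<longrightarrow> r *\<^sub>R u \<in> U)"

definition zero_nbhd_base :: "'a::locally_convex_space set set \<Rightarrow> bool" where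
  "zero_nbhd_base \<U> \<longleftrightarrow>
     (\<forall>U\<in>\<U>. open U \<and> convex U \<and> balanced U \<and> 0 \<in> U) \<and>
     (\<forall>N. 0 \<in> interior N \<longrightarrow> (\<exists>U\<in>\<U>. U \<subseteq> N))"


subsection \<open>The dual cone and its bases\<close>

definition top_dual :: "('y::locally_convex_space \<Rightarrow> real) set" where
  "top_dual = {f. linear f \<and> continuous_on UNIV f}"

text \<open>The weak* topology is the topology of pointwise convergence on the topological dual.\<close>

definition weak_star_topology :: "('y::locally_convex_space \<Rightarrow> real) topology" where
  "weak_star_topology = subtopology (product_topology (\<lambda>_. euclideanreal) UNIV) top_dual"

definition dual_cone :: "'y::locally_convex_space set \<Rightarrow> ('y \<Rightarrow> real) set" where
  "dual_cone C = {f \<in> top_dual. \<forall>c\<in>C. f c \<ge> 0}"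

text \<open>A base of a cone of functionals \<open>K\<close>: a convex subset not containing \<open>0\<close> such that every
  nonzero element of \<open>K\<close> is a positive multiple of an element of the base in exactly one way.
  The vector space operations on functionals are written out pointwise, since the library does not
  make the function type a \<open>real_vector\<close>.\<close>

definition cone_base :: "('y \<Rightarrow> real) set \<Rightarrow> ('y \<Rightarrow> real) set \<Rightarrow> bool" where
  "cone_base K W \<longleftrightarrow>
     W \<subseteq> K \<and> (\<lambda>_. 0) \<notin> W \<and>
     (\<forall>f\<in>W. \<forall>g\<in>W. \<forall>s\<in>{0..1}. (\<lambda>y. (1 - s) * f y + s * g y) \<in> W) \<and>
     (\<forall>k\<in>K - {\<lambda>_. 0}. \<exists>!(t, w). t > 0 \<and> w \<in> W \<and> k = (\<lambda>y. t * w y))"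


subsection \<open>Extended real-valued functions\<close>

definition edom :: "('a \<Rightarrow> ereal) \<Rightarrow> 'a set" where
  "edom \<phi> = {x. \<phi> x \<noteq> \<infinity>}"

definition proper :: "('a \<Rightarrow> ereal) \<Rightarrow> bool" where
  "proper \<phi> \<longleftrightarrow> edom \<phi> \<noteq> {} \<and> (\<forall>x. \<phi> x \<noteq> -\<infinity>)"

definition lower_dini :: "('a::real_vector \<Rightarrow> ereal) \<Rightarrow> 'a \<Rightarrow> 'a \<Rightarrow> ereal" where
  "lower_dini \<phi> x u =
     Liminf (at_right 0)
       (\<lambda>t::real. ereal (1 / t) * (INF \<rho>\<in>{\<rho>::real. \<phi> (x + t *\<^sub>R u) \<le> \<phi> x + ereal \<rho>}. ereal \<rho>))"

definition pseudoconvex :: "('a::real_vector \<Rightarrow> ereal) \<Rightarrow> bool" where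
  "pseudoconvex \<phi> \<longleftrightarrow>
     (\<forall>a\<in>edom \<phi>. \<forall>b\<in>edom \<phi>. \<phi> a < \<phi> b \<longrightarrow> lower_dini \<phi> b (a - b) < 0)"

definition pseudoconcave :: "('a::real_vector \<Rightarrow> ereal) \<Rightarrow> bool" where
  "pseudoconcave \<phi> \<longleftrightarrow>
     (\<forall>a\<in>edom \<phi>. \<forall>b\<in>edom \<phi>. \<phi> a > \<phi> b \<longrightarrow> lower_dini \<phi> b (a - b) > 0)"

definition radial :: "('a::real_vector \<Rightarrow> ereal) \<Rightarrow> 'a \<Rightarrow> 'a \<Rightarrow> real \<Rightarrow> ereal" where
  "radial \<phi> x0 x t = (if 0 \<le> t \<and> t \<le> 1 then \<phi> (x0 + t *\<^sub>R (x - x0)) else \<infinity>)"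

definition radially_pseudoconvex :: "('a::real_vector \<Rightarrow> ereal) \<Rightarrow> 'a \<Rightarrow> bool" where
  "radially_pseudoconvex \<phi> x0 \<longleftrightarrow> (\<forall>x. pseudoconvex (radial \<phi> x0 x))"

definition radially_pseudoconcave :: "('a::real_vector \<Rightarrow> ereal) \<Rightarrow> 'a \<Rightarrow> bool" where
  "radially_pseudoconcave \<phi> x0 \<longleftrightarrow> (\<forall>x. pseudoconcave (radial \<phi> x0 x))"


subsection \<open>Set-valued functions\<close>

definition sdom :: "('x \<Rightarrow> 'y set) \<Rightarrow> 'x set" where
  "sdom F = {x. F x \<noteq> {}}"

definition star_shaped_at :: "'a::real_vector set \<Rightarrow> 'a \<Rightarrow> bool" where
  "star_shaped_at D x0 \<longleftrightarrow>
     (\<forall>x. x0 \<in> D \<and> x \<in> D \<longrightarrow> (\<forall>t\<in>{0..1}. x0 + t *\<^sub>R (x - x0) \<in> D))"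

definition scalarization :: "('x \<Rightarrow> 'y set) \<Rightarrow> ('y \<Rightarrow> real) \<Rightarrow> 'x \<Rightarrow> ereal" where
  "scalarization F w x = (INF y\<in>F x. ereal (w y))"

definition set_radial :: "('a::real_vector \<Rightarrow> 'y set) \<Rightarrow> 'a \<Rightarrow> 'a \<Rightarrow> real \<Rightarrow> 'y set" where
  "set_radial F x0 x t = (if 0 \<le> t \<and> t \<le> 1 then F (x0 + t *\<^sub>R (x - x0)) else {})"

text \<open>Below, \<open>\<U>\<close> is the fixed \<open>0\<close>-neighborhood base of the codomain, and \<open>+\<close> on sets is the
  Minkowski sum.\<close>

definition upper_Hausdorff_continuous_at ::
  "'y::locally_convex_space set set \<Rightarrow> ('z::locally_convex_space \<Rightarrow> 'y set) \<Rightarrow> 'z \<Rightarrow> bool" where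
  "upper_Hausdorff_continuous_at \<U> G z0 \<longleftrightarrow>
     (\<forall>U\<in>\<U>. \<exists>V. 0 \<in> interior V \<and> (\<forall>z \<in> (+) z0 ` V. G z \<subseteq> G z0 + U))"

definition radially_upper_Hausdorff_continuous ::
  "'y::locally_convex_space set set \<Rightarrow> ('x::locally_convex_space \<Rightarrow> 'y set) \<Rightarrow> 'x \<Rightarrow> bool" where
  "radially_upper_Hausdorff_continuous \<U> F x0 \<longleftrightarrow>
     (\<forall>x. \<forall>t\<in>{0..1}. upper_Hausdorff_continuous_at \<U> (set_radial F x0 x) t)"

definition set_ll :: "'y::locally_convex_space set set \<Rightarrow> 'y set \<Rightarrow> 'y set \<Rightarrow> 'y set \<Rightarrow> bool" where
  "set_ll \<U> C A B \<longleftrightarrow> (\<exists>U\<in>\<U>. B + U \<subseteq> A + C)"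

definition weak_minimizer ::
  "'y::locally_convex_space set set \<Rightarrow> 'y set \<Rightarrow> ('x \<Rightarrow> 'y set) \<Rightarrow> 'x \<Rightarrow> bool" where
  "weak_minimizer \<U> C F x0 \<longleftrightarrow>
     x0 \<in> sdom F \<and> (F x0 + C = UNIV \<or> (\<forall>x. \<not> set_ll \<U> C (F x) (F x0)))"

end

theory Submission
  imports Defs
begin

text \<open>
  Suppose that some \<open>F x\<close> lies strictly below \<open>F x0\<close>, that is, \<open>F x0 + U \<subseteq> F x + C\<close> for a
  neighborhood \<open>U\<close> of \<open>0\<close>. A nonzero functional of the dual cone takes a negative value on \<open>U\<close>, so
  every scalarization drops strictly from \<open>x0\<close> to \<open>x\<close> (lemma
  \<open>scalarization_less_if_set_ll\<close>); this uses that it is finite at \<open>x0\<close>. Restrict it to the segment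
  from \<open>x0\<close> (parameter \<open>0\<close>) to \<open>x\<close> (parameter \<open>1\<close>). Pseudoconcavity of this restriction, applied at
  the lower end \<open>1\<close> towards the higher end \<open>0\<close>, makes the derivative at \<open>x\<close> in direction \<open>x0 - x\<close>
  positive (lemmas \<open>lower_dini_radial_at_1\<close> and \<open>lower_dini_pos_if_radially_pseudoconcave\<close>). This
  happens for all functionals of the base simultaneously, whereas the variational inequality at the
  very same point \<open>x\<close> provides one for which that derivative is nonpositive.
\<close>

lemma open_nhd_0_absorbing:
  fixes U :: "'a::locally_convex_space set"
  assumes "open U" "0 \<in> U"
  obtains r :: real where "r > 0" "r *\<^sub>R v \<in> U"
proof -
  have "((\<lambda>r::real. (r, v)) \<longlongrightarrow> (0, v)) (at_right 0)"
    by (intro tendsto_intros)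
  then have "filterlim (\<lambda>r::real. (r, v)) (nhds 0 \<times>\<^sub>F nhds v) (at_right 0)"
    by (simp add: nhds_prod)
  from filterlim_compose[OF tendsto_scaleR_Pair this]
  have "((\<lambda>r. r *\<^sub>R v) \<longlongrightarrow> 0) (at_right 0)"
    by simp
  then have "\<forall>\<^sub>F r in at_right 0. r *\<^sub>R v \<in> U"
    using assms by (rule topological_tendstoD)
  moreover have "\<forall>\<^sub>F r in at_right (0::real). r > 0"
    by (rule eventually_at_right_less)
  ultimately have "\<forall>\<^sub>F r in at_right 0. r > 0 \<and> r *\<^sub>R v \<in> U"
    by eventually_elim simp
  then show thesis
    using that by (auto dest: eventually_happens)
qed

lemma linear_neg_on_open_nhd_0:
  fixes w :: "'a::locally_convex_space \<Rightarrow> real"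
  assumes "linear w" "w \<noteq> (\<lambda>_. 0)" "open U" "0 \<in> U"
  obtains u where "u \<in> U" "w u < 0"
proof -
  obtain v where v: "w v \<noteq> 0"
    using assms(2) by auto
  define v' where "v' = (if w v < 0 then v else - v)"
  have neg: "w v' < 0"
    using v by (simp add: v'_def linear_neg[OF assms(1)])
  obtain r :: real where "r > 0" "r *\<^sub>R v' \<in> U"
    using open_nhd_0_absorbing[OF assms(3,4)] .
  moreover have "w (r *\<^sub>R v') < 0"
    using neg \<open>r > 0\<close> by (simp add: linear_scale[OF assms(1)] mult_pos_neg)
  ultimately show thesis
    using that by blast
qed

text \<open>
  If \<open>u \<in> U\<close> has \<open>w u < 0\<close>, each \<open>y + u\<close> with \<open>y \<in> F x0\<close> dominates some point of \<open>F x\<close>, so the infimum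
  over \<open>F x\<close> undercuts the one over \<open>F x0\<close> by at least the fixed amount \<open>- w u\<close>. The gap is
  uniform in \<open>y\<close>, hence the inequality stays strict even where no infimum is attained; it is
  strict only because the infimum over \<open>F x0\<close> is finite.
\<close>
lemma scalarization_less_if_set_ll:
  assumes base: "zero_nbhd_base \<U>"
    and ll: "set_ll \<U> C (F x) (F x0)"
    and w: "w \<in> dual_cone C" "w \<noteq> (\<lambda>_. 0)"
    and finite_x0: "\<bar>scalarization F w x0\<bar> \<noteq> \<infinity>"
  shows "scalarization F w x < scalarization F w x0"
proof -
  have lin: "linear w" and pos: "\<And>c. c \<in> C \<Longrightarrow> 0 \<le> w c"
    using w(1) by (auto simp: dual_cone_def top_dual_def)
  obtain U where U: "U \<in> \<U>" "F x0 + U \<subseteq> F x + C"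
    using ll by (auto simp: set_ll_def)
  then have "open U" "0 \<in> U"
    using base by (auto simp: zero_nbhd_base_def)
  then obtain u where u: "u \<in> U" "w u < 0"
    using linear_neg_on_open_nhd_0[OF lin w(2)] by metis
  have "scalarization F w x - ereal (w u) \<le> scalarization F w x0"
    unfolding scalarization_def[of F w x0]
  proof (rule INF_greatest)
    fix y assume "y \<in> F x0"
    then have "y + u \<in> F x + C"
      using U(2) u(1) by (blast intro: set_plus_intro)
    then obtain z c where z: "z \<in> F x" "c \<in> C" "y + u = z + c"
      by (auto elim: set_plus_elim)
    have "w z \<le> w y + w u"
      using pos[OF z(2)] arg_cong[OF z(3), of w] by (simp add: linear_add[OF lin])
    moreover have "scalarization F w x \<le> ereal (w z)"
      unfolding scalarization_def by (rule INF_lower[OF z(1)])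
    ultimately show "scalarization F w x - ereal (w u) \<le> ereal (w y)"
      by (cases "scalarization F w x") auto
  qed
  then show ?thesis
    using u(2) finite_x0
    by (cases "scalarization F w x"; cases "scalarization F w x0") auto
qed

text \<open>
  A step \<open>t\<close> backwards from the endpoint \<open>1\<close> stays in the segment as soon as \<open>t \<le> 1\<close>, so the value
  \<open>\<infinity>\<close> imposed outside the segment does not affect the limit.
\<close>
lemma lower_dini_radial_at_1:
  "lower_dini (radial \<phi> x0 x) 1 (0 - 1) = lower_dini \<phi> x (x0 - x)"
proof -
  have "radial \<phi> x0 x (1 + t *\<^sub>R (0 - 1)) = \<phi> (x + t *\<^sub>R (x0 - x))" if "0 < t" "t < 1" for t
    using that by (simp add: radial_def algebra_simps)
  moreover have "radial \<phi> x0 x 1 = \<phi> x"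
    by (simp add: radial_def)
  moreover have "\<forall>\<^sub>F t in at_right (0::real). 0 < t \<and> t < 1"
    by (auto simp: eventually_at_right[of 0 1] intro: exI[of _ 1])
  ultimately show ?thesis
    unfolding lower_dini_def by (intro Liminf_eq) (auto elim!: eventually_mono)
qed

lemma lower_dini_pos_if_radially_pseudoconcave:
  assumes "radially_pseudoconcave \<phi> x0" "\<phi> x < \<phi> x0" "\<phi> x0 \<noteq> \<infinity>"
  shows "lower_dini \<phi> x (x0 - x) > 0"
proof -
  have "pseudoconcave (radial \<phi> x0 x)"
    using assms(1) by (simp add: radially_pseudoconcave_def)
  moreover have "radial \<phi> x0 x 0 = \<phi> x0" "radial \<phi> x0 x 1 = \<phi> x"
    by (simp_all add: radial_def)
  moreover from this have "0 \<in> edom (radial \<phi> x0 x)" "1 \<in> edom (radial \<phi> x0 x)"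
    using assms(2,3) by (auto simp: edom_def)
  ultimately have "lower_dini (radial \<phi> x0 x) 1 (0 - 1) > 0"
    unfolding pseudoconcave_def using assms(2) by metis
  then show ?thesis
    by (simp only: lower_dini_radial_at_1)
qed

theorem theorem3p1:
  fixes F :: "'x::locally_convex_space \<Rightarrow> 'y::locally_convex_space set"
    and x0 :: 'x
    and C :: "'y set"
    and \<U>Y :: "'y set set"
    and W :: "('y \<Rightarrow> real) set"
  assumes "zero_nbhd_base \<U>Y"
    and "closed C" and "convex_cone C" and "interior C \<noteq> {}" and "C \<noteq> UNIV"
    and "cone_base (dual_cone C) W" and "compactin weak_star_topology W"
    and "x0 \<in> sdom F"
    and "radially_upper_Hausdorff_continuous \<U>Y F x0"
    and "star_shaped_at (sdom F) x0"
    and "compact (F x0)"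
    and "\<And>w. w \<in> W \<Longrightarrow> proper (scalarization F w)"
    and "\<And>w. w \<in> W \<Longrightarrow> radially_pseudoconvex (scalarization F w) x0"
    and "\<And>w. w \<in> W \<Longrightarrow> radially_pseudoconcave (scalarization F w) x0"
    and "\<forall>x. \<exists>w\<in>W. lower_dini (scalarization F w) x (x0 - x) \<le> 0"
  shows "weak_minimizer \<U>Y C F x0"
proof -
  have "\<not> set_ll \<U>Y C (F x) (F x0)" for x
  proof
    assume ll: "set_ll \<U>Y C (F x) (F x0)"
    obtain w where w: "w \<in> W" and dini: "lower_dini (scalarization F w) x (x0 - x) \<le> 0"
      using assms(15) by blast
    have w_dual: "w \<in> dual_cone C" "w \<noteq> (\<lambda>_. 0)"
      using assms(6) w unfolding cone_base_def by blast+
    have "scalarization F w x0 \<noteq> -\<infinity>"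
      using assms(12)[OF w] by (simp add: proper_def)
    moreover obtain y where "y \<in> F x0"
      using assms(8) by (auto simp: sdom_def)
    then have "scalarization F w x0 \<le> ereal (w y)"
      unfolding scalarization_def by (rule INF_lower)
    ultimately have fin: "\<bar>scalarization F w x0\<bar> \<noteq> \<infinity>"
      by auto
    have "scalarization F w x < scalarization F w x0"
      by (rule scalarization_less_if_set_ll[OF assms(1) ll w_dual fin])
    moreover have "scalarization F w x0 \<noteq> \<infinity>"
      using fin by auto
    ultimately have "lower_dini (scalarization F w) x (x0 - x) > 0"
      by (rule lower_dini_pos_if_radially_pseudoconcave[OF assms(14)[OF w]])
    with dini show False
      by simp
  qed
  then show ?thesis
    using assms(8) by (simp add: weak_minimizer_def)
qed

end
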